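(* Let $G$ be a connected finite simple graph of order $n\geq 2$, let $I$ be an independent set in $G$, and let $M$ be a matching in $\overline{G\setminus I}$, the complement of the subgraph of $G$ induced by $V(G)\setminus I$. Then $\chi_{md}(G)\leq n-|M|-|I|+1$, and the bound is sharp (e.g. equality holds for $G=K_n$).
   Context: For a vertex $v$, $N[v]=N(v)\cup\{v\}$; $v$ dominates exactly the vertices of $N[v]$. A majority dominator coloring of $G$ is a proper vertex coloring such that for every vertex $v$ there is a color class $C$ with $|N[v]\cap C|\geq |C|/2$. $\chi_{md}(G)$ is the minimum number of color classes in a majority dominator coloring of $G$. $\overline{H}$ denotes the complement of a graph $H$, and $|M|$ is the number of edges of the matching. *)

theory Defs
  imports "Graph_Theory.Graph_Theory"
begin

text \<open>
  A finite simple graph is a digraph in the locale \<^term>\<open>graph\<close>: finite, symmetric, loop-free and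
  without parallel arcs. Each undirected edge \<open>uv\<close> is thus a pair of opposite arcs, so edges are
  counted as unordered pairs of end vertices.
\<close>

definition undirected_edges :: "('a, 'b) pre_digraph \<Rightarrow> 'a set set" where
  "undirected_edges G = {{u, v} | u v. u \<rightarrow>\<^bsub>G\<^esub> v}"

definition graph_complement :: "('a, 'b) pre_digraph \<Rightarrow> ('a, 'a \<times> 'a) pre_digraph" where
  "graph_complement G = with_proj
     \<lparr> pverts = verts G,
       parcs = {(u, v). u \<in> verts G \<and> v \<in> verts G \<and> u \<noteq> v \<and> \<not> u \<rightarrow>\<^bsub>G\<^esub> v} \<rparr>"

definition independent_set :: "('a, 'b) pre_digraph \<Rightarrow> 'a set \<Rightarrow> bool" where
  "independent_set G I \<longleftrightarrow> I \<subseteq> verts G \<and> (\<forall>u\<in>I. \<forall>v\<in>I. \<not> u \<rightarrow>\<^bsub>G\<^esub> v)"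

definition matching :: "('a, 'b) pre_digraph \<Rightarrow> 'a set set \<Rightarrow> bool" where
  "matching G M \<longleftrightarrow> M \<subseteq> undirected_edges G \<and> pairwise disjnt M"

definition closed_neighborhood :: "('a, 'b) pre_digraph \<Rightarrow> 'a \<Rightarrow> 'a set" where
  "closed_neighborhood G v = insert v {u. v \<rightarrow>\<^bsub>G\<^esub> u}"

definition proper_coloring :: "('a, 'b) pre_digraph \<Rightarrow> ('a \<Rightarrow> nat) \<Rightarrow> bool" where
  "proper_coloring G c \<longleftrightarrow> (\<forall>u v. u \<rightarrow>\<^bsub>G\<^esub> v \<longrightarrow> c u \<noteq> c v)"

text \<open>
  Only colors that occur on a vertex give a class: an empty class would satisfy the domination
  inequality below trivially.
\<close>

definition color_classes :: "('a, 'b) pre_digraph \<Rightarrow> ('a \<Rightarrow> nat) \<Rightarrow> 'a set set" where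
  "color_classes G c = (\<lambda>k. {v \<in> verts G. c v = k}) ` c ` verts G"

definition majority_dominator_coloring :: "('a, 'b) pre_digraph \<Rightarrow> ('a \<Rightarrow> nat) \<Rightarrow> bool" where
  "majority_dominator_coloring G c \<longleftrightarrow> proper_coloring G c \<and>
     (\<forall>v\<in>verts G. \<exists>C\<in>color_classes G c.
        real (card (closed_neighborhood G v \<inter> C)) \<ge> real (card C) / 2)"

text \<open>
  For a finite graph the minimum is over a nonempty set, since giving all vertices different colors
  is a majority dominator coloring.
\<close>

definition majority_dominator_number :: "('a, 'b) pre_digraph \<Rightarrow> nat" (\<open>\<chi>\<^sub>m\<^sub>d\<close>) where
  "\<chi>\<^sub>m\<^sub>d G = (LEAST k. \<exists>c. majority_dominator_coloring G c \<and> card (color_classes G c) = k)"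

end

theory Submission
  imports Defs "HOL-Library.Disjoint_Sets"
begin

text \<open>
  Color \<open>I\<close> with one color, each edge of \<open>M\<close> with one color, and every remaining vertex with a
  color of its own. A class with at most two vertices is dominated by each vertex whose closed
  neighborhood meets it. So a vertex outside \<open>I\<close> dominates its own class, and a vertex of \<open>I\<close>
  dominates the class of any of its neighbors, all of which lie outside \<open>I\<close>. For a complete graph,
  every proper coloring is injective.
\<close>

section \<open>Complements, and colorings viewed as partitions\<close>

text \<open>Both ends lie in \<open>S\<close>, so an arc of \<open>G\<close> between them would
  survive in \<open>G \<restriction> S\<close>; nonadjacency therefore transfers back to
  \<open>G\<close> itself.\<close>

lemma dominates_graph_complement_induce:
  assumes "u \<rightarrow>\<^bsub>graph_complement (G \<restriction> S)\<^esub> v"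
  shows "u \<in> S" and "v \<in> S" and "u \<noteq> v" and "\<not> u \<rightarrow>\<^bsub>G\<^esub> v"
  using assms by (auto simp: graph_complement_def arcs_ends_conv)

text \<open>A finite partition has an injective numbering of its blocks, and coloring each vertex by
  the number of its block recovers exactly the blocks as classes.\<close>

lemma color_classes_of_partition:
  assumes "finite (verts G)" and P: "partition_on (verts G) P"
  obtains c where "color_classes G c = P" and "\<And>X v. X \<in> P \<Longrightarrow> v \<in> X \<Longrightarrow> X = {u \<in> verts G. c u = c v}"
proof -
  have "finite P"
    using assms by (rule finite_elements)
  then obtain f :: "'a set \<Rightarrow> nat" where f: "inj_on f P"
    using finite_imp_inj_to_nat_seg[of P] by auto
  \<comment> \<open>On \<open>verts G\<close> the description is unique, because blocks are disjoint
    and cover the vertices.\<close>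
  define c where "c v = f (THE X. X \<in> P \<and> v \<in> X)" for v
  have "(THE Y. Y \<in> P \<and> v \<in> Y) = X" if "X \<in> P" "v \<in> X" for X v
    using that partition_onD2[OF P] by (intro the_equality) (auto dest: disjointD)
  then have c: "c v = f X" if "X \<in> P" "v \<in> X" for X v
    using that by (simp add: c_def)
  have class_eq: "X = {u \<in> verts G. c u = c v}" if "X \<in> P" "v \<in> X" for X v
  proof (intro equalityI subsetI)
    fix u assume "u \<in> X"
    then show "u \<in> {u \<in> verts G. c u = c v}"
      using that c partition_onD1[OF P] by auto
  next
    fix u assume u: "u \<in> {u \<in> verts G. c u = c v}"
    then obtain Y where "Y \<in> P" "u \<in> Y"
      using partition_onD1[OF P] by auto
    with u that c f show "u \<in> X"
      by (auto dest: inj_onD)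
  qed
  have "color_classes G c = (\<lambda>v. {u \<in> verts G. c u = c v}) ` verts G"
    by (auto simp: color_classes_def)
  also have "\<dots> = P"
  proof (intro equalityI subsetI)
    fix X assume "X \<in> (\<lambda>v. {u \<in> verts G. c u = c v}) ` verts G"
    then show "X \<in> P"
      using class_eq partition_onD1[OF P] by fastforce
  next
    fix X assume X: "X \<in> P"
    then obtain v where "v \<in> X"
      using partition_onD3[OF P] by fastforce
    then show "X \<in> (\<lambda>v. {u \<in> verts G. c u = c v}) ` verts G"
      using X class_eq partition_onD1[OF P] by blast
  qed
  finally show thesis
    using class_eq by (rule that)
qed

text \<open>Reduces upper bounds to exhibiting a partition into independent blocks, with no color
  function to construct. Doubling on the right replaces the halving of reals.\<close>

lemma majority_dominator_number_le_card_partition: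
  assumes "wf_digraph G" "finite (verts G)" "partition_on (verts G) P"
    and indep: "\<And>X u v. X \<in> P \<Longrightarrow> u \<in> X \<Longrightarrow> v \<in> X \<Longrightarrow> \<not> u \<rightarrow>\<^bsub>G\<^esub> v"
    and dom: "\<And>v. v \<in> verts G \<Longrightarrow> \<exists>X\<in>P. card X \<le> 2 * card (closed_neighborhood G v \<inter> X)"
  shows "\<chi>\<^sub>m\<^sub>d G \<le> card P"
proof -
  interpret wf_digraph G by fact
  obtain c where c: "color_classes G c = P"
    and class_eq: "\<And>X v. X \<in> P \<Longrightarrow> v \<in> X \<Longrightarrow> X = {u \<in> verts G. c u = c v}"
    using color_classes_of_partition assms(2,3) by blast
  have "proper_coloring G c"
    unfolding proper_coloring_def
  proof (intro allI impI notI)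
    fix u v assume uv: "u \<rightarrow>\<^bsub>G\<^esub> v" "c u = c v"
    then have "u \<in> verts G" "v \<in> verts G"
      by (auto dest: adj_in_verts)
    then obtain X where "X \<in> P" "u \<in> X"
      using partition_onD1[OF assms(3)] by blast
    with class_eq uv \<open>v \<in> verts G\<close> have "v \<in> X"
      by fastforce
    with indep \<open>X \<in> P\<close> \<open>u \<in> X\<close> uv show False
      by blast
  qed
  moreover have "\<exists>C\<in>P. real (card (closed_neighborhood G v \<inter> C)) \<ge> real (card C) / 2"
    if v: "v \<in> verts G" for v
  proof -
    obtain X where "X \<in> P" "card X \<le> 2 * card (closed_neighborhood G v \<inter> X)"
      using dom[OF v] by blast
    then show ?thesis
      by (intro bexI[of _ X]) linarith+
  qed
  ultimately have "majority_dominator_coloring G c"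
    by (simp add: majority_dominator_coloring_def c)
  then show ?thesis
    unfolding majority_dominator_number_def using c by (blast intro: Least_le)
qed

section \<open>The upper bound\<close>

lemma card_Union_pairs:
  assumes "finite M" "pairwise disjnt M" "\<And>e. e \<in> M \<Longrightarrow> card e = 2"
  shows "card (\<Union>M) = 2 * card M"
proof -
  have "card (\<Union>M) = sum card M"
    using assms by (intro card_Union_disjoint) (auto intro: card_ge_0_finite)
  with assms show ?thesis by simp
qed

text \<open>By symmetry of the arcs, a directed path leads from \<open>v\<close> to some other
  vertex; its first arc gives the neighbor.\<close>

lemma (in graph) connected_imp_neighbor:
  assumes "connected G" "card (verts G) \<ge> 2" "v \<in> verts G"
  obtains w where "v \<rightarrow> w"
proof -
  have "\<not> verts G \<subseteq> {v}"
    using assms(2) card_mono[of "{v}" "verts G"] by auto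
  then obtain u where "u \<in> verts G" "u \<noteq> v"
    by blast
  moreover from this have "v \<rightarrow>\<^sup>* u"
    using symmetric_connected_imp_strongly_connected[OF sym_arcs assms(1)] assms(3)
    by (auto simp: strongly_connected_def)
  ultimately show thesis
    using that converse_reachable_cases by metis
qed

lemma (in graph) majority_dominator_number_le:
  assumes conn: "connected G" and card2: "card (verts G) \<ge> 2" and I: "independent_set G I"
    and M: "matching (graph_complement (G \<restriction> (verts G - I))) M"
  shows "int (\<chi>\<^sub>m\<^sub>d G) \<le> int (card (verts G)) - int (card M) - int (card I) + 1"
proof -
  have "I \<subseteq> verts G" and I_indep: "\<And>u v. u \<in> I \<Longrightarrow> v \<in> I \<Longrightarrow> \<not> u \<rightarrow> v"
    using I by (auto simp: independent_set_def)
  \<comment> \<open>Adjacency is excluded in both directions because independence of a block is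
    checked on all ordered pairs of its vertices.\<close>
  have edge: "\<exists>u v. e = {u, v} \<and> u \<noteq> v \<and> u \<in> verts G - I \<and> v \<in> verts G - I \<and> \<not> u \<rightarrow> v \<and> \<not> v \<rightarrow> u"
    if "e \<in> M" for e
  proof -
    have "e \<in> undirected_edges (graph_complement (G \<restriction> (verts G - I)))"
      using M that by (auto simp: matching_def)
    then obtain u v where e: "e = {u, v}" "u \<rightarrow>\<^bsub>graph_complement (G \<restriction> (verts G - I))\<^esub> v"
      unfolding undirected_edges_def by blast
    moreover have "\<not> v \<rightarrow> u"
      using dominates_graph_complement_induce(4)[OF e(2)] arcs_ends_symmetric[OF sym_arcs] by blast
    ultimately show ?thesis
      using dominates_graph_complement_induce[OF e(2)] by blast
  qed
  define R where "R = verts G - I - \<Union>M"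
  define S where "S = M \<union> (\<lambda>v. {v}) ` R"
  \<comment> \<open>Blocks must be nonempty, so \<open>I\<close> is dropped when it is empty. Either
    way it contributes at most one block, the source of the \<open>+ 1\<close> in the bound.\<close>
  define P where "P = ({I} - {{}}) \<union> S"
  have UM: "\<Union>M \<subseteq> verts G - I"
    using edge by blast
  have fin_UM: "finite (\<Union>M)"
    using UM finite_verts by (meson finite_Diff finite_subset)
  have "finite M"
    using fin_UM by (rule finite_UnionD)
  have card_edge: "card e = 2" if "e \<in> M" for e
    using edge[OF that] by auto
  have disj: "pairwise disjnt M"
    using M by (simp add: matching_def)
  \<comment> \<open>With at most two elements, a block of \<open>S\<close> is half covered as soon
    as a single element of it lies in the closed neighborhood.\<close>
  have small: "card X \<le> 2" "finite X" if "X \<in> S" for X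
    using that card_edge by (auto simp: S_def intro: card_ge_0_finite)
  have cover: "\<exists>X\<in>S. v \<in> X" if "v \<in> verts G - I" for v
    using that by (auto simp: S_def R_def)
  have "partition_on (verts G) P"
  proof (rule partition_onI)
    show "\<Union>P = verts G"
      using UM \<open>I \<subseteq> verts G\<close> by (auto simp: P_def S_def R_def)
    show "{} \<notin> P"
      using card_edge by (force simp: P_def S_def)
    fix p q assume "p \<in> P" "q \<in> P" "p \<noteq> q"
    then show "disjnt p q"
      using UM pairwiseD[OF disj, of p q] by (auto simp: P_def S_def R_def disjnt_iff)
  qed
  moreover have "\<not> u \<rightarrow> v" if "X \<in> P" "u \<in> X" "v \<in> X" for X u v
    using that I_indep edge adj_not_same by (fastforce simp: P_def S_def)
  moreover have "\<exists>X\<in>P. card X \<le> 2 * card (closed_neighborhood G v \<inter> X)" if v: "v \<in> verts G" for v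
  proof -
    \<comment> \<open>The block of a vertex \<open>w\<close> outside \<open>I\<close> belongs to
      \<open>S\<close>, so it is small. Take \<open>v\<close> itself if it lies outside
      \<open>I\<close>, and otherwise a neighbor, which independence keeps out of
      \<open>I\<close>.\<close>
    obtain w where w: "w \<in> closed_neighborhood G v" "w \<in> verts G - I"
    proof (cases "v \<in> I")
      case True
      obtain w where "v \<rightarrow> w"
        using connected_imp_neighbor[OF conn card2 v] .
      then show thesis
        using that[of w] I_indep True adj_in_verts by (auto simp: closed_neighborhood_def)
    next
      case False
      then show thesis
        using that[of v] v by (auto simp: closed_neighborhood_def)
    qed
    obtain X where X: "X \<in> S" "w \<in> X"
      using cover[OF w(2)] by blast
    then have "card (closed_neighborhood G v \<inter> X) > 0"
      using small(2) w(1) by (auto simp: card_gt_0_iff)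
    then show ?thesis
      using small(1)[OF X(1)] X(1) by (intro bexI[of _ X]) (auto simp: P_def)
  qed
  ultimately have "\<chi>\<^sub>m\<^sub>d G \<le> card P"
    by (intro majority_dominator_number_le_card_partition wf_digraph_axioms finite_verts)
  also have "card P \<le> card ({I} - {{}}) + (card M + card ((\<lambda>v. {v}) ` R))"
    unfolding P_def S_def by (meson add_left_mono card_Un_le le_trans)
  also have "\<dots> \<le> 1 + (card M + card R)"
    by (intro add_mono card_image_le order_refl card_Diff1_le[THEN order_trans])
       (auto simp: R_def)
  finally have "\<chi>\<^sub>m\<^sub>d G \<le> 1 + (card M + card R)" .
  \<comment> \<open>Each matching edge uses two vertices but only one color, so eliminating
    \<open>card R\<close> from \<open>1 + (card M + card R)\<close> leaves a saving of
    \<open>card M\<close>.\<close>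
  moreover have "card R + 2 * card M + card I = card (verts G)"
  proof -
    have "card R + card (\<Union>M) = card (verts G - I)"
      unfolding R_def using UM fin_UM finite_verts
      by (metis card_Diff_subset card_mono finite_Diff le_add_diff_inverse2)
    moreover have "card (verts G - I) + card I = card (verts G)"
      using \<open>I \<subseteq> verts G\<close> finite_verts
      by (metis card_Diff_subset card_mono finite_subset le_add_diff_inverse2)
    ultimately show ?thesis
      using card_Union_pairs[OF \<open>finite M\<close> disj card_edge] by simp
  qed
  ultimately show ?thesis by linarith
qed

section \<open>Complete graphs and sharpness\<close>

text \<open>Shows that the sharpness example exists for every order; an arbitrary vertex type could
  have too few elements.\<close>

lemma complete_digraph_exists: "\<exists>K :: (nat, nat \<times> nat) pre_digraph. complete_digraph n K"
proof
  show "complete_digraph n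
      (with_proj \<lparr>pverts = {..<n}, parcs = {(u, v). (u, v) \<in> {..<n} \<times> {..<n} \<and> u \<noteq> v}\<rparr>)"
    unfolding complete_digraph_pair_def by simp
qed

lemma complete_digraph_connected:
  assumes "complete_digraph n K" "n > 0"
  shows "connected K"
proof -
  interpret graph K
    using assms by (simp add: complete_digraph_def)
  have "u \<rightarrow>\<^sup>*\<^bsub>K\<^esub> v" if "u \<in> verts K" "v \<in> verts K" for u v
    using assms that by (cases "u = v") (auto simp: complete_digraph_def)
  moreover have "verts K \<noteq> {}"
    using assms by (auto simp: complete_digraph_def)
  ultimately have "strongly_connected K"
    by blast
  then show ?thesis
    by (simp add: connected_def strongly_connected_def reachable_mk_symmetric_eq[OF sym_arcs])
qed

lemma card_color_classes_complete_digraph: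
  assumes "complete_digraph n K" "proper_coloring K c"
  shows "card (color_classes K c) = n"
proof -
  have "inj_on c (verts K)"
    using assms by (auto simp: complete_digraph_def proper_coloring_def inj_on_def)
  \<comment> \<open>Colors range over attained values only, so the fibers are nonempty and distinct
    colors give distinct classes.\<close>
  moreover have "inj_on (\<lambda>k. {v \<in> verts K. c v = k}) (c ` verts K)"
    by (auto simp: inj_on_def)
  ultimately show ?thesis
    using assms(1) by (simp add: color_classes_def card_image complete_digraph_def)
qed

text \<open>Every class is a singleton, and each vertex dominates its own. This supplies the
  coloring that makes the set under \<open>LEAST\<close> nonempty.\<close>

lemma majority_dominator_coloring_injective:
  assumes "loopfree_digraph G" "inj_on c (verts G)"
  shows "majority_dominator_coloring G c"
proof -
  interpret loopfree_digraph G by fact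
  have "proper_coloring G c"
    unfolding proper_coloring_def using assms(2) adj_not_same adj_in_verts by (metis inj_onD)
  moreover have "\<exists>C\<in>color_classes G c. real (card (closed_neighborhood G v \<inter> C)) \<ge> real (card C) / 2"
    if v: "v \<in> verts G" for v
  proof -
    have "{u \<in> verts G. c u = c v} = {v}"
      using assms(2) v by (auto dest: inj_onD)
    then have "{v} \<in> color_classes G c"
      using v by (force simp: color_classes_def)
    then show ?thesis
      by (rule rev_bexI) (simp add: closed_neighborhood_def)
  qed
  ultimately show ?thesis
    by (simp add: majority_dominator_coloring_def)
qed

text \<open>All majority dominator colorings of a complete graph have the same number of classes, so
  the existence of one fixes the minimum.\<close>

lemma majority_dominator_number_complete_digraph:
  assumes K: "complete_digraph n K"
  shows "\<chi>\<^sub>m\<^sub>d K = n"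
proof -
  interpret graph K
    using K by (simp add: complete_digraph_def)
  obtain c :: "'a \<Rightarrow> nat" where "inj_on c (verts K)"
    using finite_imp_inj_to_nat_seg[OF finite_verts] by auto
  then have c: "majority_dominator_coloring K c"
    using majority_dominator_coloring_injective loopfree_digraph_axioms by blast
  have "card (color_classes K d) = n" if "majority_dominator_coloring K d" for d
    using card_color_classes_complete_digraph[OF K] that
    by (simp add: majority_dominator_coloring_def)
  with c show ?thesis
    unfolding majority_dominator_number_def by (intro Least_equality) auto
qed

theorem theorem2p2:
  shows "(\<forall>(G :: ('a, 'b) pre_digraph) I M.
            graph G \<and> connected G \<and> card (verts G) \<ge> 2 \<and> independent_set G I \<and>
            matching (graph_complement (G \<restriction> (verts G - I))) M \<longrightarrow>
            int (\<chi>\<^sub>m\<^sub>d G) \<le> int (card (verts G)) - int (card M) - int (card I) + 1)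
       \<and> (\<forall>n \<ge> 2.
            (\<exists>K :: (nat, nat \<times> nat) pre_digraph. complete_digraph n K) \<and>
            (\<forall>K :: ('a, 'b) pre_digraph. complete_digraph n K \<longrightarrow>
               graph K \<and> connected K \<and> card (verts K) = n \<and>
               (\<exists>I M. independent_set K I \<and>
                  matching (graph_complement (K \<restriction> (verts K - I))) M \<and>
                  int (\<chi>\<^sub>m\<^sub>d K) = int n - int (card M) - int (card I) + 1)))"
proof (intro conjI allI impI)
  fix G :: "('a, 'b) pre_digraph" and I M
  assume "graph G \<and> connected G \<and> card (verts G) \<ge> 2 \<and> independent_set G I \<and>
    matching (graph_complement (G \<restriction> (verts G - I))) M"
  then show "int (\<chi>\<^sub>m\<^sub>d G) \<le> int (card (verts G)) - int (card M) - int (card I) + 1"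
    using graph.majority_dominator_number_le by blast
next
  fix n :: nat
  show "\<exists>K :: (nat, nat \<times> nat) pre_digraph. complete_digraph n K"
    by (rule complete_digraph_exists)
next
  fix n :: nat and K :: "('a, 'b) pre_digraph"
  assume n: "n \<ge> 2" and K: "complete_digraph n K"
  then show "graph K" "card (verts K) = n"
    by (simp_all add: complete_digraph_def)
  show "connected K"
    using complete_digraph_connected[OF K] n by simp
  obtain v where v: "v \<in> verts K"
    using n K by (force simp: complete_digraph_def)
  \<comment> \<open>With a single vertex as \<open>I\<close> and the empty matching the bound reads
    \<open>n - 0 - 1 + 1\<close>, which is \<open>n\<close>.\<close>
  have "independent_set K {v}"
    using v K by (auto simp: independent_set_def complete_digraph_def)
  moreover have "matching (graph_complement (K \<restriction> (verts K - {v}))) {}"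
    by (simp add: matching_def)
  moreover have "int (\<chi>\<^sub>m\<^sub>d K) = int n - int (card ({} :: 'a set set)) - int (card {v}) + 1"
    using majority_dominator_number_complete_digraph[OF K] by simp
  ultimately show "\<exists>I M. independent_set K I \<and>
      matching (graph_complement (K \<restriction> (verts K - I))) M \<and>
      int (\<chi>\<^sub>m\<^sub>d K) = int n - int (card M) - int (card I) + 1"
    by blast
qed

end
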